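(* Let $k$ be a field of characteristic different from $2$, let $\varepsilon\in\{\pm1\}$, and let $\delta\in k$, with $\delta=0$ if $\varepsilon=-1$. Let $r,s\ge 0$ be integers. Then the set of (equivalence classes of) standard marked Brauer diagrams for $(r,s)$ is a homogeneous basis of the $\mathbb{Z}_2$-graded vector space $B_{r,s}(\delta,\varepsilon)$. In particular, if $r+s=2n$ is even, then $$\dim_k B_{r,s}(\delta,\varepsilon)=\frac{(2n)!}{2^n\, n!}=(2n-1)!!.$$
   Context: A Brauer diagram for $(r,s)$ is a partition of the set $\{1,\dots,r,1',\dots,s'\}$ into two-element subsets (edges), drawn in the plane with vertices $1,\dots,r$ from left to right in a top row and $1',\dots,s'$ from left to right in a bottom row. An edge joining two top vertices is a cup, an edge joining two bottom vertices is a cap, and any other edge is a through string. A marked Brauer diagram is a Brauer diagram in which each cup carries one bead and each cap carries one arrow (pointing along the edge, either toward its left or toward its right endpoint), such that no two markings (beads or arrows) are at the same height. Up to equivalence (isotopy never putting two markings at the same height) it is the data of: the Brauer diagram, the total order of all markings from top to bottom, and a direction (left or right) for each arrow. Two markings are adjacent if no other marking has height strictly between them. $B_{r,s}(\delta,\varepsilon)$ is the $k$-vector space spanned by the marked Brauer diagrams for $(r,s)$ subject to the relations: (i) if $D_2$ is obtained from $D_1$ by interchanging the heights of two adjacent markings, then $D_1=\varepsilon D_2$; (ii) if $D_2$ is obtained from $D_1$ by reversing the direction of one arrow, then $D_1=\varepsilon D_2$. If $r+s$ is odd, $B_{r,s}(\delta,\varepsilon)=0$. $\mathbb{Z}_2$-grading: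 if $\varepsilon=1$ every marked Brauer diagram is even; if $\varepsilon=-1$ the degree of a marked Brauer diagram is its number of markings modulo $2$. Total order on the markings of a diagram: it is induced by the following total order on its cups and caps. All cups come before all caps; the cups are in increasing order by their left vertices (a cup whose left vertex is further left comes earlier); the caps are in decreasing order by their left vertices (a cap whose left vertex is further right comes earlier). A marked Brauer diagram is standard if every arrow points to the right and every marking is lower (in height) than all markings which come earlier in this total order. *)

theory Defs
  imports "Jordan_Normal_Form.Missing_VectorSpace" "HOL-Library.Disjoint_Sets"
    "HOL-Library.Z2" "HOL-Algebra.AbelCoset" "HOL-Algebra.Multiplicative_Group"
begin

section \<open>Brauer diagrams and markings\<close>

datatype vertex = Top nat | Bot nat

fun position :: "vertex \<Rightarrow> nat" where
  "position (Top i) = i"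
| "position (Bot i) = i"

type_synonym edge = "vertex set"

definition vertices :: "nat \<Rightarrow> nat \<Rightarrow> vertex set" where
  "vertices r s = Top ` {1..r} \<union> Bot ` {1..s}"

definition brauer_diagrams :: "nat \<Rightarrow> nat \<Rightarrow> edge set set" where
  "brauer_diagrams r s = {E. partition_on (vertices r s) E \<and> (\<forall>e\<in>E. card e = 2)}"

definition is_cup :: "edge \<Rightarrow> bool" where
  "is_cup e \<longleftrightarrow> e \<subseteq> range Top"

definition is_cap :: "edge \<Rightarrow> bool" where
  "is_cap e \<longleftrightarrow> e \<subseteq> range Bot"

datatype direction = Leftward | Rightward

datatype marking =
    Bead (edge_of: edge)
  | Arrow (edge_of: edge) (direction_of: direction)

text \<open>
  A marked Brauer diagram, up to isotopy, is recorded as its underlying Brauer diagram together with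
  the list of all its markings, read from top (greatest height) to bottom. The relative heights of
  the markings are the only part of the planar picture that the isotopy class remembers besides the
  diagram and the directions of the arrows.
\<close>

type_synonym marked_diagram = "edge set \<times> marking list"

definition marked_diagrams :: "nat \<Rightarrow> nat \<Rightarrow> marked_diagram set" where
  "marked_diagrams r s = {(E, ms).
     E \<in> brauer_diagrams r s \<and>
     distinct (map edge_of ms) \<and>
     {e. Bead e \<in> set ms} = {e \<in> E. is_cup e} \<and>
     {e. \<exists>d. Arrow e d \<in> set ms} = {e \<in> E. is_cap e}}"

definition height_swap :: "marked_diagram \<Rightarrow> marked_diagram \<Rightarrow> bool" where
  "height_swap D\<^sub>1 D\<^sub>2 \<longleftrightarrow>
     (\<exists>E ms a b ms'. D\<^sub>1 = (E, ms @ [a, b] @ ms') \<and> D\<^sub>2 = (E, ms @ [b, a] @ ms'))"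

definition arrow_reversal :: "marked_diagram \<Rightarrow> marked_diagram \<Rightarrow> bool" where
  "arrow_reversal D\<^sub>1 D\<^sub>2 \<longleftrightarrow>
     (\<exists>E ms e d d' ms'. d \<noteq> d' \<and>
        D\<^sub>1 = (E, ms @ [Arrow e d] @ ms') \<and> D\<^sub>2 = (E, ms @ [Arrow e d'] @ ms'))"

text \<open>
  For cups and caps both endpoints lie in the same row, so the left vertex of an edge is determined
  by the smaller of the two positions.
\<close>

definition left_position :: "edge \<Rightarrow> nat" where
  "left_position e = Min (position ` e)"

definition comes_before :: "edge \<Rightarrow> edge \<Rightarrow> bool" where
  "comes_before e f \<longleftrightarrow>
     is_cup e \<and> is_cap f \<or>
     is_cup e \<and> is_cup f \<and> left_position e < left_position f \<or>
     is_cap e \<and> is_cap f \<and> left_position f < left_position e"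

text \<open>Markings are listed from top to bottom, so a larger index means lower in height.\<close>

definition standard :: "marked_diagram \<Rightarrow> bool" where
  "standard D \<longleftrightarrow> (case D of (E, ms) \<Rightarrow>
     (\<forall>e d. Arrow e d \<in> set ms \<longrightarrow> d = Rightward) \<and>
     (\<forall>i < length ms. \<forall>j < length ms.
        comes_before (edge_of (ms ! i)) (edge_of (ms ! j)) \<longrightarrow> i < j))"

definition standard_diagrams :: "nat \<Rightarrow> nat \<Rightarrow> marked_diagram set" where
  "standard_diagrams r s = {D \<in> marked_diagrams r s. standard D}"


section \<open>Quotient modules\<close>

text \<open>The fields \<open>mult\<close> and \<open>one\<close> of a module record carry no meaning.\<close>

definition quotient_module ::
    "('a, 'b, 'm) module_scheme \<Rightarrow> 'b set \<Rightarrow> ('a, 'b set) module" where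
  "quotient_module M N =
     \<lparr>carrier = a_rcosets\<^bsub>M\<^esub> N,
      mult = (\<lambda>X Y. N),
      one = N,
      zero = N,
      add = (\<lambda>X Y. X <+>\<^bsub>M\<^esub> Y),
      smult = (\<lambda>a X. \<Union>x\<in>X. N +>\<^bsub>M\<^esub> (a \<odot>\<^bsub>M\<^esub> x))\<rparr>"


section \<open>The space spanned by marked Brauer diagrams\<close>

text \<open>
  There are only finitely many marked diagrams for given \<open>r\<close> and \<open>s\<close> (see below), so the
  functions from them to the field form the free vector space on them.
\<close>

definition free_space ::
    "('k, 'm) ring_scheme \<Rightarrow> nat \<Rightarrow> nat \<Rightarrow> ('k, marked_diagram \<Rightarrow> 'k) module" where
  "free_space K r s = ring.func_space K (marked_diagrams r s)"

definition generator ::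
    "('k, 'm) ring_scheme \<Rightarrow> nat \<Rightarrow> nat \<Rightarrow> marked_diagram \<Rightarrow> marked_diagram \<Rightarrow> 'k" where
  "generator K r s D = (\<lambda>D' \<in> marked_diagrams r s. if D' = D then \<one>\<^bsub>K\<^esub> else \<zero>\<^bsub>K\<^esub>)"

definition relators ::
    "('k, 'm) ring_scheme \<Rightarrow> nat \<Rightarrow> nat \<Rightarrow> 'k \<Rightarrow> (marked_diagram \<Rightarrow> 'k) set" where
  "relators K r s \<epsilon> =
     {generator K r s D\<^sub>1 \<ominus>\<^bsub>free_space K r s\<^esub> \<epsilon> \<odot>\<^bsub>free_space K r s\<^esub> generator K r s D\<^sub>2 | D\<^sub>1 D\<^sub>2.
        D\<^sub>1 \<in> marked_diagrams r s \<and> D\<^sub>2 \<in> marked_diagrams r s \<and>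
        (height_swap D\<^sub>1 D\<^sub>2 \<or> arrow_reversal D\<^sub>1 D\<^sub>2)}"

definition relation_space ::
    "('k, 'm) ring_scheme \<Rightarrow> nat \<Rightarrow> nat \<Rightarrow> 'k \<Rightarrow> (marked_diagram \<Rightarrow> 'k) set" where
  "relation_space K r s \<epsilon> = LinearCombinations.module.span K (free_space K r s) (relators K r s \<epsilon>)"

text \<open>
  The parameter \<open>\<delta>\<close> does not influence the vector space (it only enters the composition of
  diagrams). For odd \<open>r + s\<close> there are no Brauer diagrams, and the space is zero.
\<close>

definition brauer_space ::
    "('k, 'm) ring_scheme \<Rightarrow> nat \<Rightarrow> nat \<Rightarrow> 'k \<Rightarrow> 'k \<Rightarrow> ('k, (marked_diagram \<Rightarrow> 'k) set) module" where
  "brauer_space K r s \<delta> \<epsilon> = quotient_module (free_space K r s) (relation_space K r s \<epsilon>)"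

definition diagram_class ::
    "('k, 'm) ring_scheme \<Rightarrow> nat \<Rightarrow> nat \<Rightarrow> 'k \<Rightarrow> 'k \<Rightarrow> marked_diagram \<Rightarrow> (marked_diagram \<Rightarrow> 'k) set" where
  "diagram_class K r s \<delta> \<epsilon> D = relation_space K r s \<epsilon> +>\<^bsub>free_space K r s\<^esub> generator K r s D"


section \<open>The grading\<close>

text \<open>Here \<open>bit\<close> is the type of integers modulo two.\<close>

definition diagram_degree :: "('k, 'm) ring_scheme \<Rightarrow> 'k \<Rightarrow> marked_diagram \<Rightarrow> bit" where
  "diagram_degree K \<epsilon> D = (if \<epsilon> = \<one>\<^bsub>K\<^esub> then 0 else of_nat (length (snd D)))"

definition brauer_component ::
    "('k, 'm) ring_scheme \<Rightarrow> nat \<Rightarrow> nat \<Rightarrow> 'k \<Rightarrow> 'k \<Rightarrow> bit \<Rightarrow> (marked_diagram \<Rightarrow> 'k) set set" where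
  "brauer_component K r s \<delta> \<epsilon> i =
     LinearCombinations.module.span K (brauer_space K r s \<delta> \<epsilon>)
       (diagram_class K r s \<delta> \<epsilon> ` {D \<in> marked_diagrams r s. diagram_degree K \<epsilon> D = i})"

definition Z2_graded ::
    "('k, 'm) ring_scheme \<Rightarrow> ('k, 'v, 'n) module_scheme \<Rightarrow> (bit \<Rightarrow> 'v set) \<Rightarrow> bool" where
  "Z2_graded K V W \<longleftrightarrow> vectorspace K V \<and> VectorSpace.subspace K (W 0) V \<and> VectorSpace.subspace K (W 1) V \<and>
     LinearCombinations.module.submodule_sum V (W 0) (W 1) = carrier V \<and> W 0 \<inter> W 1 = {\<zero>\<^bsub>V\<^esub>}"

definition homogeneous_basis ::
    "('k, 'm) ring_scheme \<Rightarrow> ('k, 'v, 'n) module_scheme \<Rightarrow> (bit \<Rightarrow> 'v set) \<Rightarrow> 'v set \<Rightarrow> bool" where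
  "homogeneous_basis K V W A \<longleftrightarrow>
     Z2_graded K V W \<and> vectorspace.basis K V A \<and> (\<forall>v\<in>A. \<exists>i. v \<in> W i)"

text \<open>
  The additive order of the unit is the characteristic, because \<open>ord\<close> is zero for
  elements of infinite order.
\<close>

definition characteristic :: "('k, 'm) ring_scheme \<Rightarrow> nat" where
  "characteristic K = group.ord (add_monoid K) \<one>\<^bsub>K\<^esub>"


section \<open>Well-definedness of the space and its grading\<close>

lemma finite_marked_diagrams: "finite (marked_diagrams r s)"
proof -
  let ?P = "Pow (vertices r s)"
  let ?M = "Bead ` ?P \<union> (\<lambda>(e, d). Arrow e d) ` (?P \<times> {Leftward, Rightward})"
  have P: "finite ?P" by (simp add: vertices_def)
  have M: "finite ?M" using P by simp
  have "marked_diagrams r s \<subseteq> Pow ?P \<times> {ms. set ms \<subseteq> ?M \<and> length ms \<le> card ?P}"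
  proof
    fix D assume "D \<in> marked_diagrams r s"
    then obtain E ms where D: "D = (E, ms)" and E: "partition_on (vertices r s) E"
      and dist: "distinct (map edge_of ms)"
      and beads: "{e. Bead e \<in> set ms} = {e \<in> E. is_cup e}"
      and arrows: "{e. \<exists>d. Arrow e d \<in> set ms} = {e \<in> E. is_cap e}"
      by (auto simp: marked_diagrams_def brauer_diagrams_def)
    have EP: "E \<subseteq> ?P" using E by (auto simp: partition_on_def)
    have ms: "set ms \<subseteq> ?M"
    proof
      fix m assume m: "m \<in> set ms"
      show "m \<in> ?M"
      proof (cases m)
        case (Bead e)
        then show ?thesis using m beads EP by blast
      next
        case (Arrow e d)
        then have "e \<in> ?P" using m arrows EP by blast
        then show ?thesis using Arrow by (cases d) auto
      qed
    qed
    have "set (map edge_of ms) \<subseteq> ?P" using ms by fastforce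
    then have "length (map edge_of ms) \<le> card ?P"
      using distinct_card[OF dist] card_mono[OF P] by metis
    then show "D \<in> Pow ?P \<times> {ms. set ms \<subseteq> ?M \<and> length ms \<le> card ?P}"
      using D EP ms by simp
  qed
  then show ?thesis
    by (rule finite_subset) (use P finite_lists_length_le[OF M] in simp)
qed

lemma quotient_module_module:
  assumes "submodule R N M"
  shows "Module.module R (quotient_module M N)"
    and "mod_hom R M (quotient_module M N) (\<lambda>x. N +>\<^bsub>M\<^esub> x)"
proof -
  interpret submodule R N M by fact
  interpret Module.module R M by (rule module)
  have m_neg: "(\<ominus>\<^bsub>R\<^esub> \<one>\<^bsub>R\<^esub>) \<odot>\<^bsub>M\<^esub> x \<in> N" if "x \<in> N" for x
    using that by (intro submodule.smult_closed[OF assms]) auto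
  have neg: "\<ominus>\<^bsub>M\<^esub> x \<in> N" if "x \<in> N" for x
    using that m_neg[OF that] smult_l_minus[of "\<one>\<^bsub>R\<^esub>" x] subsetD[OF subset that] by simp
  have sg: "subgroup N (add_monoid M)"
    by (rule subgroup.intro) (use subset neg in \<open>auto simp: a_inv_def\<close>)
  interpret S: abelian_subgroup N M
    by (intro abelian_subgroupI3 additive_subgroupI sg M.abelian_group_axioms)
  let ?Q = "quotient_module M N"
  have cl: "N +>\<^bsub>M\<^esub> x \<in> carrier ?Q" if "x \<in> carrier M" for x
    using that subset by (simp add: quotient_module_def M.a_rcosetsI)
  have ex: "\<exists>x\<in>carrier M. X = N +>\<^bsub>M\<^esub> x" if "X \<in> carrier ?Q" for X
    using that by (auto simp: quotient_module_def A_RCOSETS_def')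
  have add: "(N +>\<^bsub>M\<^esub> x) \<oplus>\<^bsub>?Q\<^esub> (N +>\<^bsub>M\<^esub> y) = N +>\<^bsub>M\<^esub> (x \<oplus>\<^bsub>M\<^esub> y)"
    if "x \<in> carrier M" "y \<in> carrier M" for x y
    using that by (simp add: quotient_module_def S.a_rcos_sum)
  have smult: "a \<odot>\<^bsub>?Q\<^esub> (N +>\<^bsub>M\<^esub> x) = N +>\<^bsub>M\<^esub> (a \<odot>\<^bsub>M\<^esub> x)"
    if "x \<in> carrier M" "a \<in> carrier R" for x a
  proof -
    have "N +>\<^bsub>M\<^esub> (a \<odot>\<^bsub>M\<^esub> y) = N +>\<^bsub>M\<^esub> (a \<odot>\<^bsub>M\<^esub> x)" if y: "y \<in> N +>\<^bsub>M\<^esub> x" for y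
    proof -
      obtain n where n: "n \<in> N" "y = n \<oplus>\<^bsub>M\<^esub> x" using y by (auto simp: a_r_coset_def')
      then have "a \<odot>\<^bsub>M\<^esub> y = a \<odot>\<^bsub>M\<^esub> n \<oplus>\<^bsub>M\<^esub> a \<odot>\<^bsub>M\<^esub> x"
        using \<open>x \<in> carrier M\<close> \<open>a \<in> carrier R\<close> subset by (auto simp: smult_r_distr)
      moreover have "a \<odot>\<^bsub>M\<^esub> n \<in> N" using n \<open>a \<in> carrier R\<close> by simp
      ultimately have "a \<odot>\<^bsub>M\<^esub> y \<in> N +>\<^bsub>M\<^esub> (a \<odot>\<^bsub>M\<^esub> x)" by (auto simp: a_r_coset_def')
      then show ?thesis
        using M.a_repr_independence[OF _ _ sg] that \<open>x \<in> carrier M\<close> \<open>a \<in> carrier R\<close> by simp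
    qed
    moreover have "x \<in> N +>\<^bsub>M\<^esub> x" using that(1) by (rule S.a_rcos_self)
    ultimately have "(\<Union>y\<in>N +>\<^bsub>M\<^esub> x. N +>\<^bsub>M\<^esub> (a \<odot>\<^bsub>M\<^esub> y)) = N +>\<^bsub>M\<^esub> (a \<odot>\<^bsub>M\<^esub> x)"
      by blast
    then show ?thesis by (simp add: quotient_module_def)
  qed
  have zero: "\<zero>\<^bsub>?Q\<^esub> = N +>\<^bsub>M\<^esub> \<zero>\<^bsub>M\<^esub>"
    using M.a_coset_join2[OF M.zero_closed sg] by (simp add: quotient_module_def)
  have ag: "abelian_group ?Q"
  proof (rule abelian_groupI)
    fix X Y assume "X \<in> carrier ?Q" "Y \<in> carrier ?Q"
    then obtain x y where "x \<in> carrier M" "X = N +>\<^bsub>M\<^esub> x" "y \<in> carrier M" "Y = N +>\<^bsub>M\<^esub> y"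
      using ex by blast
    then show "X \<oplus>\<^bsub>?Q\<^esub> Y \<in> carrier ?Q" "X \<oplus>\<^bsub>?Q\<^esub> Y = Y \<oplus>\<^bsub>?Q\<^esub> X"
      by (simp_all add: add cl M.a_comm)
  next
    show "\<zero>\<^bsub>?Q\<^esub> \<in> carrier ?Q" using cl[OF M.zero_closed] zero by simp
  next
    fix X Y Z assume "X \<in> carrier ?Q" "Y \<in> carrier ?Q" "Z \<in> carrier ?Q"
    then show "(X \<oplus>\<^bsub>?Q\<^esub> Y) \<oplus>\<^bsub>?Q\<^esub> Z = X \<oplus>\<^bsub>?Q\<^esub> (Y \<oplus>\<^bsub>?Q\<^esub> Z)"
      using ex[of X] ex[of Y] ex[of Z] by (auto simp: add M.a_assoc)
  next
    fix X assume "X \<in> carrier ?Q"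
    then obtain x where x: "x \<in> carrier M" "X = N +>\<^bsub>M\<^esub> x" using ex by blast
    then show "\<zero>\<^bsub>?Q\<^esub> \<oplus>\<^bsub>?Q\<^esub> X = X" by (simp add: zero add)
    have "(N +>\<^bsub>M\<^esub> (\<ominus>\<^bsub>M\<^esub> x)) \<oplus>\<^bsub>?Q\<^esub> X = \<zero>\<^bsub>?Q\<^esub>" using x by (simp add: zero add M.l_neg)
    then show "\<exists>Y\<in>carrier ?Q. Y \<oplus>\<^bsub>?Q\<^esub> X = \<zero>\<^bsub>?Q\<^esub>" using cl[of "\<ominus>\<^bsub>M\<^esub> x"] x by blast
  qed
  show Q: "Module.module R ?Q"
  proof (rule moduleI)
    fix a X assume "a \<in> carrier R" "X \<in> carrier ?Q"
    then show "a \<odot>\<^bsub>?Q\<^esub> X \<in> carrier ?Q" using ex smult cl by fastforce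
  next
    fix a b X assume "a \<in> carrier R" "b \<in> carrier R" "X \<in> carrier ?Q"
    then show "(a \<oplus>\<^bsub>R\<^esub> b) \<odot>\<^bsub>?Q\<^esub> X = a \<odot>\<^bsub>?Q\<^esub> X \<oplus>\<^bsub>?Q\<^esub> b \<odot>\<^bsub>?Q\<^esub> X"
      using ex[of X] by (auto simp: smult add smult_l_distr)
  next
    fix a X Y assume "a \<in> carrier R" "X \<in> carrier ?Q" "Y \<in> carrier ?Q"
    then show "a \<odot>\<^bsub>?Q\<^esub> (X \<oplus>\<^bsub>?Q\<^esub> Y) = a \<odot>\<^bsub>?Q\<^esub> X \<oplus>\<^bsub>?Q\<^esub> a \<odot>\<^bsub>?Q\<^esub> Y"
      using ex[of X] ex[of Y] by (auto simp: smult add smult_r_distr)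
  next
    fix a b X assume "a \<in> carrier R" "b \<in> carrier R" "X \<in> carrier ?Q"
    then show "(a \<otimes>\<^bsub>R\<^esub> b) \<odot>\<^bsub>?Q\<^esub> X = a \<odot>\<^bsub>?Q\<^esub> (b \<odot>\<^bsub>?Q\<^esub> X)"
      using ex[of X] by (auto simp: smult smult_assoc1)
  next
    fix X assume "X \<in> carrier ?Q"
    then show "\<one>\<^bsub>R\<^esub> \<odot>\<^bsub>?Q\<^esub> X = X" using ex[of X] by (auto simp: smult)
  qed (use ag R.cring_axioms in auto)
  show "mod_hom R M ?Q (\<lambda>x. N +>\<^bsub>M\<^esub> x)"
  proof (intro mod_hom.intro mod_hom_axioms.intro Q module)
    show "(\<lambda>x. N +>\<^bsub>M\<^esub> x) \<in> LinearCombinations.module_hom R M ?Q"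
      using cl by (simp add: LinearCombinations.module_hom_def add smult)
  qed
qed


lemma length_markings:
  assumes "(E, ms) \<in> marked_diagrams r s"
  shows "finite E" "length ms = card {e \<in> E. is_cup e} + card {e \<in> E. is_cap e}"
proof -
  have E: "partition_on (vertices r s) E" "\<forall>e\<in>E. card e = 2" and dist: "distinct (map edge_of ms)"
    and beads: "{e. Bead e \<in> set ms} = {e \<in> E. is_cup e}"
    and arrows: "{e. \<exists>d. Arrow e d \<in> set ms} = {e \<in> E. is_cap e}"
    using assms by (auto simp: marked_diagrams_def brauer_diagrams_def)
  show fin: "finite E"
    using E(1) finite_elements[of "vertices r s" E] by (simp add: vertices_def)
  have "edge_of ` set ms = {e. Bead e \<in> set ms} \<union> {e. \<exists>d. Arrow e d \<in> set ms}"
  proof safe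
    fix m assume m: "m \<in> set ms" "\<nexists>d. Arrow (edge_of m) d \<in> set ms"
    show "Bead (edge_of m) \<in> set ms"
    proof (cases m)
      case (Bead e)
      then show ?thesis using m(1) by simp
    next
      case (Arrow e d)
      then have "Arrow (edge_of m) d \<in> set ms" using m(1) by simp
      then show ?thesis using m(2) by blast
    qed
  qed force+
  then have "set (map edge_of ms) = {e \<in> E. is_cup e} \<union> {e \<in> E. is_cap e}"
    using beads arrows by simp
  moreover have "\<not> (is_cup e \<and> is_cap e)" if "e \<in> E" for e
  proof -
    have "card e = 2" using E(2) that by blast
    then obtain u v where "e = {u, v}" unfolding card_2_iff by blast
    then show ?thesis by (auto simp: is_cup_def is_cap_def)
  qed
  then have "{e \<in> E. is_cup e} \<inter> {e \<in> E. is_cap e} = {}" by blast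
  ultimately show "length ms = card {e \<in> E. is_cup e} + card {e \<in> E. is_cap e}"
    using distinct_card[OF dist] fin by (simp add: card_Un_disjoint)
qed

lemma cups_minus_caps:
  assumes "(E, ms) \<in> marked_diagrams r s"
  shows "2 * int (card {e \<in> E. is_cup e}) - 2 * int (card {e \<in> E. is_cap e}) = int r - int s"
proof -
  have E: "partition_on (vertices r s) E" "\<forall>e\<in>E. card e = 2"
    using assms by (auto simp: marked_diagrams_def brauer_diagrams_def)
  have fin: "finite E" using length_markings[OF assms] by simp
  have sum: "card (vertices r s \<inter> T) = (\<Sum>e\<in>E. card (e \<inter> T))" for T
  proof -
    have "vertices r s \<inter> T = (\<Union>e\<in>E. e \<inter> T)" using E(1) by (auto simp: partition_on_def)
    moreover have "card (\<Union>e\<in>E. e \<inter> T) = (\<Sum>e\<in>E. card (e \<inter> T))"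
    proof (rule card_UN_disjoint[OF fin])
      show "\<forall>e\<in>E. finite (e \<inter> T)" using E(2) by (metis card.infinite finite_Int zero_neq_numeral)
      show "\<forall>e\<in>E. \<forall>f\<in>E. e \<noteq> f \<longrightarrow> (e \<inter> T) \<inter> (f \<inter> T) = {}"
        using E(1) by (auto simp: partition_on_def disjoint_def)
    qed
    ultimately show ?thesis by simp
  qed
  have "vertices r s \<inter> range Top = Top ` {1..r}" "vertices r s \<inter> range Bot = Bot ` {1..s}"
    by (auto simp: vertices_def)
  then have r: "card (vertices r s \<inter> range Top) = r" and s: "card (vertices r s \<inter> range Bot) = s"
    by (simp_all add: card_image inj_on_def)
  have edge: "int (card (e \<inter> range Top)) - int (card (e \<inter> range Bot)) =
      (if is_cup e then 2 else 0) - (if is_cap e then 2 else 0)" if "e \<in> E" for e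
  proof -
    have "card e = 2" using E(2) that by blast
    then obtain u v where uv: "e = {u, v}" "u \<noteq> v" unfolding card_2_iff by blast
    show ?thesis
      using uv by (cases u; cases v) (auto simp: is_cup_def is_cap_def Int_insert_left)
  qed
  have "int r - int s = (\<Sum>e\<in>E. int (card (e \<inter> range Top)) - int (card (e \<inter> range Bot)))"
    using sum[of "range Top"] sum[of "range Bot"] r s by (simp add: sum_subtractf flip: of_nat_sum)
  also have "\<dots> = (\<Sum>e\<in>E. (if is_cup e then 2 else 0)) - (\<Sum>e\<in>E. (if is_cap e then 2 else 0))"
    by (simp add: edge sum_subtractf)
  also have "\<dots> = 2 * int (card {e \<in> E. is_cup e}) - 2 * int (card {e \<in> E. is_cap e})"
    using fin by (simp add: sum.If_cases Int_def)
  finally show ?thesis by simp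
qed

lemma diagram_degree_unique:
  assumes "D \<in> marked_diagrams r s" "D' \<in> marked_diagrams r s"
  shows "diagram_degree K \<epsilon> D = diagram_degree K \<epsilon> D'"
proof -
  obtain E ms E' ms' where D: "D = (E, ms)" "D' = (E', ms')" by fastforce
  have "even (length ms) \<longleftrightarrow> even (length ms')"
    using length_markings(2)[of E ms r s] length_markings(2)[of E' ms' r s]
      cups_minus_caps[of E ms r s] cups_minus_caps[of E' ms' r s] assms D
    by simp presburger
  then have "(of_nat (length ms) :: bit) = of_nat (length ms')"
    by (cases "even (length ms)") (auto elim!: evenE oddE)
  then show ?thesis by (simp add: diagram_degree_def D)
qed

context
  fixes K :: "('k, 'm) ring_scheme" (structure)
    and r s :: nat
    and \<epsilon> \<delta> :: 'k
  assumes K: "field K" and \<epsilon>: "\<epsilon> \<in> carrier K"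
begin

interpretation K: field K by (rule K)

lemma free_space_module: "Module.module K (free_space K r s)"
  unfolding free_space_def by (rule K.func_space_is_module)

interpretation F: Module.module K "free_space K r s" by (rule free_space_module)

lemma generator_closed: "generator K r s D \<in> carrier (free_space K r s)"
  by (auto simp: generator_def free_space_def K.func_space_def)

lemma relation_space_submodule: "submodule K (relation_space K r s \<epsilon>) (free_space K r s)"
  unfolding relation_space_def
proof (rule F.span_is_submodule)
  show "relators K r s \<epsilon> \<subseteq> carrier (free_space K r s)"
    unfolding relators_def using generator_closed F.smult_closed[OF \<epsilon>] F.M.minus_closed by blast
qed

lemma brauer_space_vectorspace: "vectorspace K (brauer_space K r s \<delta> \<epsilon>)"
  unfolding brauer_space_def
  by (intro vectorspace.intro quotient_module_module relation_space_submodule K)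

interpretation V: vectorspace K "brauer_space K r s \<delta> \<epsilon>"
  by (rule brauer_space_vectorspace)

interpretation Q: mod_hom K "free_space K r s" "brauer_space K r s \<delta> \<epsilon>"
    "\<lambda>f. relation_space K r s \<epsilon> +>\<^bsub>free_space K r s\<^esub> f"
  unfolding brauer_space_def by (intro quotient_module_module relation_space_submodule)

lemma diagram_class_closed: "diagram_class K r s \<delta> \<epsilon> D \<in> carrier (brauer_space K r s \<delta> \<epsilon>)"
  unfolding diagram_class_def by (rule Q.f_im) (rule generator_closed)

lemma span_diagram_classes:
  "V.span (diagram_class K r s \<delta> \<epsilon> ` marked_diagrams r s) = carrier (brauer_space K r s \<delta> \<epsilon>)"
proof -
  let ?F = "free_space K r s" and ?N = "relation_space K r s \<epsilon>" and ?M = "marked_diagrams r s"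
  let ?S = "V.span (diagram_class K r s \<delta> \<epsilon> ` ?M)"
  have sub: "submodule K ?S (brauer_space K r s \<delta> \<epsilon>)"
    by (rule V.span_is_submodule) (use diagram_class_closed in auto)
  have gen: "diagram_class K r s \<delta> \<epsilon> D \<in> ?S" if "D \<in> ?M" for D
    using V.in_own_span[of "diagram_class K r s \<delta> \<epsilon> ` ?M"] diagram_class_closed that
    by (meson image_subset_iff imageI subsetD)
  have support: "?N +>\<^bsub>?F\<^esub> f \<in> ?S"
    if "finite A" "f \<in> carrier ?F" "\<forall>D\<in>?M - A. f D = \<zero>" for A f
    using that
  proof (induction A arbitrary: f rule: finite_induct)
    case empty
    then have "f = \<zero>\<^bsub>?F\<^esub>"
      by (auto simp: free_space_def K.func_space_def PiE_def extensional_def restrict_def)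
    then show ?case using submodule.zero_closed[OF sub] by simp
  next
    case (insert D A)
    show ?case
    proof (cases "D \<in> ?M")
      case False
      then show ?thesis using insert by (intro insert.IH) auto
    next
      case True
      define g where "g = f(D := \<zero>)"
      have f: "f \<in> ?M \<rightarrow>\<^sub>E carrier K"
        using insert.prems by (simp add: free_space_def K.func_space_def)
      have fD: "f D \<in> carrier K" using f True by auto
      have g: "g \<in> carrier ?F"
        using f True by (auto simp: g_def free_space_def K.func_space_def PiE_def extensional_def)
      have "f = g \<oplus>\<^bsub>?F\<^esub> f D \<odot>\<^bsub>?F\<^esub> generator K r s D"
      proof
        fix x show "f x = (g \<oplus>\<^bsub>?F\<^esub> f D \<odot>\<^bsub>?F\<^esub> generator K r s D) x"
          using f fD True PiE_mem[OF f, of x] PiE_arb[OF f, of x]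
          by (auto simp: g_def generator_def free_space_def K.func_space_def)
      qed
      then have "?N +>\<^bsub>?F\<^esub> f = (?N +>\<^bsub>?F\<^esub> g) \<oplus>\<^bsub>brauer_space K r s \<delta> \<epsilon>\<^esub>
          f D \<odot>\<^bsub>brauer_space K r s \<delta> \<epsilon>\<^esub> diagram_class K r s \<delta> \<epsilon> D"
        unfolding diagram_class_def
        using g fD generator_closed by (metis Q.f_add Q.f_smult F.smult_closed)
      moreover have "?N +>\<^bsub>?F\<^esub> g \<in> ?S"
        using insert.prems(2) by (intro insert.IH g) (auto simp: g_def)
      ultimately show ?thesis
        using submodule.m_closed[OF sub] submodule.smult_closed[OF sub fD gen[OF True]] by simp
    qed
  qed
  have "carrier (brauer_space K r s \<delta> \<epsilon>) \<subseteq> ?S"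
  proof
    fix X assume "X \<in> carrier (brauer_space K r s \<delta> \<epsilon>)"
    then obtain f where "f \<in> carrier ?F" "X = ?N +>\<^bsub>?F\<^esub> f"
      by (auto simp: brauer_space_def quotient_module_def A_RCOSETS_def')
    then show "X \<in> ?S" using support[OF finite_marked_diagrams[of r s]] by simp
  qed
  moreover have "?S \<subseteq> carrier (brauer_space K r s \<delta> \<epsilon>)" using submodule.subset[OF sub] .
  ultimately show ?thesis by blast
qed

lemma brauer_space_graded:
  "Z2_graded K (brauer_space K r s \<delta> \<epsilon>) (brauer_component K r s \<delta> \<epsilon>)"
proof -
  let ?V = "brauer_space K r s \<delta> \<epsilon>" and ?W = "brauer_component K r s \<delta> \<epsilon>"
  let ?M = "marked_diagrams r s"
  have sub: "VectorSpace.subspace K (?W i) ?V" for i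
    unfolding brauer_component_def
    by (rule V.span_is_subspace) (use diagram_class_closed in auto)
  then have smod: "submodule K (?W i) ?V" for i by simp
  have "\<exists>c. \<forall>D\<in>?M. diagram_degree K \<epsilon> D = c" using diagram_degree_unique by metis
  then obtain c where c: "\<forall>D\<in>?M. diagram_degree K \<epsilon> D = c" ..
  have "{D \<in> ?M. diagram_degree K \<epsilon> D = c} = ?M" using c by blast
  then have Wc: "?W c = carrier ?V"
    unfolding brauer_component_def using span_diagram_classes by simp
  have Wi: "?W i = {\<zero>\<^bsub>?V\<^esub>}" if "i \<noteq> c" for i
  proof -
    have "{D \<in> ?M. diagram_degree K \<epsilon> D = i} = {}" using c that by blast
    then show ?thesis unfolding brauer_component_def by (simp only: image_empty V.span_empty)
  qed
  have sum: "carrier ?V \<subseteq> V.submodule_sum (?W 0) (?W 1)"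
    using V.in_sum[OF smod[of 0] smod[of 1]] V.in_sum[OF smod[of 1] smod[of 0]]
      V.msum_comm[OF smod[of 0] smod[of 1]] Wc by (cases c) auto
  have "V.submodule_sum (?W 0) (?W 1) \<subseteq> carrier ?V"
    using submodule.subset[OF V.sum_is_submodule[OF smod[of 0] smod[of 1]]] .
  moreover have "?W 0 \<inter> ?W 1 = {\<zero>\<^bsub>?V\<^esub>}"
    using Wc Wi[of 0] Wi[of 1] by (cases c) auto
  ultimately show ?thesis
    unfolding Z2_graded_def using sum sub brauer_space_vectorspace by auto
qed

end

end

theory Submission
  imports Defs
begin

text \<open>
  The defect of a marked diagram is the number of pairs of markings in the wrong height order plus
  the number of arrows pointing left. Each elementary move changes it by exactly one, so
  \<open>\<epsilon> ^ defect\<close> is a sign compatible with both relations. As long as the defect is positive, some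
  move lowers it, and defect zero means standard; hence the standard diagrams span. For a fixed
  Brauer diagram \<open>E\<close>, the signed sum of the coefficients over all markings of \<open>E\<close> is a linear
  functional that kills every relator and is \<open>1\<close> on the unique standard marking of \<open>E\<close>; these
  functionals separate the standard diagrams. The dimension is therefore the number of perfect
  matchings of \<open>r + s\<close> points, counted by choosing the partner of one point.
\<close>

section \<open>Inversions of a list\<close>

text \<open>\<open>P\<close> reads as "belongs earlier than". It stays a parameter so that the count
  can be pulled back along a map.\<close>

primrec inversions :: "('a \<Rightarrow> 'a \<Rightarrow> bool) \<Rightarrow> 'a list \<Rightarrow> nat" where
  "inversions P [] = 0"
| "inversions P (x # xs) = length (filter (\<lambda>y. P y x) xs) + inversions P xs"

text \<open>Exchanging two neighbours keeps the relative position of every other pair, so only the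
  pair itself changes its contribution.\<close>

lemma inversions_swap:
  assumes "P a b" "\<not> P b a"
  shows "inversions P (xs @ [b, a] @ ys) = Suc (inversions P (xs @ [a, b] @ ys))"
  using assms by (induction xs) auto

lemma inversions_eq_0_iff: "inversions P xs = 0 \<longleftrightarrow> sorted_wrt (\<lambda>x y. \<not> P y x) xs"
  by (induction xs) (auto simp: filter_empty_conv)

text \<open>Lets an inversion count of markings be read off the list of their edges, which an arrow
  reversal leaves fixed.\<close>

lemma inversions_map: "inversions P (map f xs) = inversions (\<lambda>x y. P (f x) (f y)) xs"
  by (induction xs) (auto simp: filter_map o_def)

text \<open>Supplies the adjacent offending pair to which a height swap is applied.\<close>

lemma not_successively_split:
  assumes "\<not> successively P xs"
  obtains ys a b zs where "xs = ys @ [a, b] @ zs" "\<not> P a b"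
proof -
  have "\<exists>ys a b zs. xs = ys @ [a, b] @ zs \<and> \<not> P a b"
    using assms
  proof (induction P xs rule: successively.induct)
    case (3 P x y xs)
    show ?case
    proof (cases "P x y")
      case True
      then obtain ys a b zs where "y # xs = ys @ [a, b] @ zs" "\<not> P a b"
        using 3 by auto
      then show ?thesis by (metis append_Cons)
    qed (metis append_Cons append_Nil)
  qed auto
  then show thesis using that by blast
qed

text \<open>If the heads differed, each would occur in the tail of the other list, so
  \<open>P\<close> would hold in both directions, against antisymmetry.\<close>

lemma sorted_wrt_distinct_set_unique:
  assumes "sorted_wrt P xs" "sorted_wrt P ys" "distinct xs" "distinct ys" "set xs = set ys"
    and "\<And>x y. x \<in> set xs \<Longrightarrow> y \<in> set xs \<Longrightarrow> P x y \<Longrightarrow> P y x \<Longrightarrow> x = y"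
  shows "xs = ys"
  using assms
proof (induction xs arbitrary: ys)
  case (Cons x xs)
  then obtain y zs where ys: "ys = y # zs" by (cases ys) auto
  have "x = y"
  proof (rule ccontr)
    assume "x \<noteq> y"
    then have "x \<in> set zs" "y \<in> set xs" using Cons.prems(5) ys by auto
    then have "P y x" "P x y" using Cons.prems(1,2) ys by auto
    then show False using Cons.prems(6)[of x y] \<open>x \<noteq> y\<close> \<open>y \<in> set xs\<close> by auto
  qed
  moreover have "xs = zs"
  proof (rule Cons.IH)
    show "set xs = set zs" using Cons.prems(3,4,5) ys \<open>x = y\<close> by auto
    show "a = b" if "a \<in> set xs" "b \<in> set xs" "P a b" "P b a" for a b
      using Cons.prems(6)[of a b] that by simp
  qed (use Cons.prems(1-4) ys in auto)
  ultimately show ?case using ys by simp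
qed simp


section \<open>Counting perfect matchings\<close>

text \<open>Brauer diagrams on an arbitrary point set, so that an induction may delete two
  points.\<close>

definition perfect_matchings :: "'a set \<Rightarrow> 'a set set set" where
  "perfect_matchings A = {E. partition_on A E \<and> (\<forall>e\<in>E. card e = 2)}"

lemma perfect_matchings_empty: "perfect_matchings {} = {{}}"
  by (auto simp: perfect_matchings_def partition_on_empty)

lemma finite_perfect_matchings: "finite A \<Longrightarrow> finite (perfect_matchings A)"
  by (rule finite_subset[of _ "Pow (Pow A)"]) (auto simp: perfect_matchings_def partition_on_def)

text \<open>With \<open>perfect_matchings_remove\<close>, this gives the correspondence between
  matchings of \<open>A\<close> containing the edge \<open>{v, w}\<close> and matchings of the
  remaining points.\<close>

lemma insert_perfect_matchings:
  assumes "E \<in> perfect_matchings (A - {v, w})" "v \<in> A" "w \<in> A" "v \<noteq> w"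
  shows "insert {v, w} E \<in> perfect_matchings A"
proof -
  have "partition_on (A - {v, w}) E" using assms by (simp add: perfect_matchings_def)
  moreover from this have "disjnt {v, w} (\<Union>E)" by (auto simp: partition_on_def disjnt_def)
  ultimately have "partition_on A (insert {v, w} E)" using assms partition_on_insert by fast
  then show ?thesis using assms by (auto simp: perfect_matchings_def)
qed

lemma perfect_matchings_remove:
  assumes "E \<in> perfect_matchings A" "{v, w} \<in> E"
  shows "E - {{v, w}} \<in> perfect_matchings (A - {v, w})"
proof -
  have E: "partition_on A E" "insert {v, w} (E - {{v, w}}) = E"
    using assms by (auto simp: perfect_matchings_def)
  have "e \<inter> {v, w} = {}" if "e \<in> E - {{v, w}}" for e
    using E(1) assms(2) that by (simp add: partition_on_def disjoint_def)
  then have "disjnt {v, w} (\<Union>(E - {{v, w}}))" unfolding disjnt_def by blast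
  then have "partition_on (A - {v, w}) (E - {{v, w}})"
    using partition_on_insert[of "{v, w}" "E - {{v, w}}" A] E by simp
  then show ?thesis using assms by (auto simp: perfect_matchings_def)
qed

lemma perfect_matchings_partner:
  assumes "E \<in> perfect_matchings A" "v \<in> A"
  obtains w where "w \<in> A - {v}" "{v, w} \<in> E"
proof -
  obtain e where e: "e \<in> E" "v \<in> e"
    using assms by (auto simp: perfect_matchings_def partition_on_def)
  then have "card e = 2" using assms by (auto simp: perfect_matchings_def)
  then obtain x y where xy: "e = {x, y}" "x \<noteq> y" unfolding card_2_iff by blast
  have "e \<subseteq> A" using assms e by (auto simp: perfect_matchings_def partition_on_def)
  with e xy show thesis using that[of x] that[of y] by (auto simp: insert_commute)
qed

text \<open>Matchings of 2n+2 points fall into 2n+1 disjoint classes according to the partner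
  \<open>w\<close> of a fixed point \<open>v\<close>. Each class has as many elements as there are
  matchings of the other 2n points.\<close>

lemma card_perfect_matchings:
  assumes "finite A" "card A = 2 * n"
  shows "card (perfect_matchings A) = (\<Prod>i = 1..n. 2 * i - 1)"
  using assms
proof (induction n arbitrary: A)
  case 0
  then show ?case by (simp add: perfect_matchings_empty)
next
  case (Suc n)
  then have "A \<noteq> {}" by auto
  then obtain v where v: "v \<in> A" by blast
  let ?M = "\<lambda>w. insert {v, w} ` perfect_matchings (A - {v, w})"
  have disj: "?M w \<inter> ?M w' = {}" if "w \<in> A - {v}" "w' \<in> A - {v}" "w \<noteq> w'" for w w'
  proof -
    have False if E: "E \<in> ?M w" "E \<in> ?M w'" for E
    proof -
      have "E \<in> perfect_matchings A"
        using E(1) insert_perfect_matchings[of _ A v w] v \<open>w \<in> A - {v}\<close> by auto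
      then have "disjoint E" by (simp add: perfect_matchings_def partition_on_def)
      moreover have "{v, w} \<in> E" using E(1) by blast
      moreover have "{v, w'} \<in> E" using E(2) by blast
      moreover have "{v, w} \<inter> {v, w'} \<noteq> {}" by simp
      ultimately have "{v, w} = {v, w'}" using disjointD by metis
      then show False using \<open>w \<noteq> w'\<close> by (auto simp: doubleton_eq_iff)
    qed
    then show ?thesis by (meson disjoint_iff)
  qed
  have card_M: "card (?M w) = (\<Prod>i = 1..n. 2 * i - 1)" if w: "w \<in> A - {v}" for w
  proof -
    \<comment> \<open>The edge is new to every matching of the smaller set, so inserting it is
      injective.\<close>
    have "{v, w} \<notin> E" if "E \<in> perfect_matchings (A - {v, w})" for E
      using that by (auto simp: perfect_matchings_def partition_on_def)
    then have "inj_on (insert {v, w}) (perfect_matchings (A - {v, w}))"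
      by (intro inj_onI) (metis insert_ident)
    moreover have "card (A - {v, w}) = 2 * n"
      using Suc.prems v w by (subst card_Diff_subset) auto
    ultimately show ?thesis using Suc by (simp add: card_image)
  qed
  have "perfect_matchings A = (\<Union>w\<in>A - {v}. ?M w)"
  proof
    show "perfect_matchings A \<subseteq> (\<Union>w\<in>A - {v}. ?M w)"
    proof
      fix E assume E: "E \<in> perfect_matchings A"
      obtain w where w: "w \<in> A - {v}" "{v, w} \<in> E" using perfect_matchings_partner[OF E v] .
      have "E = insert {v, w} (E - {{v, w}})" using w by blast
      then show "E \<in> (\<Union>w\<in>A - {v}. ?M w)"
        using perfect_matchings_remove[OF E w(2)] w(1) by blast
    qed
  qed (use insert_perfect_matchings v in fast)
  also have "card \<dots> = (\<Sum>w\<in>A - {v}. card (?M w))"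
    using Suc.prems disj by (intro card_UN_disjoint) (auto simp: finite_perfect_matchings)
  also have "\<dots> = (2 * n + 1) * (\<Prod>i = 1..n. 2 * i - 1)"
    using card_M Suc.prems v by simp
  finally show ?case by simp
qed

lemma card_brauer_diagrams:
  assumes "r + s = 2 * n"
  shows "card (brauer_diagrams r s) = (\<Prod>i = 1..n. 2 * i - 1)"
proof -
  have "card (vertices r s) = 2 * n"
    unfolding vertices_def using assms
    by (subst card_Un_disjoint) (auto simp: card_image inj_on_def)
  then show ?thesis
    using card_perfect_matchings[of "vertices r s" n]
    by (simp add: perfect_matchings_def brauer_diagrams_def vertices_def)
qed

text \<open>The factor \<open>2 ^ n * fact n\<close> is the product of the even numbers up to 2n and
  completes the odd ones to \<open>fact (2 * n)\<close>. The identity is proved over the naturals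
  and only then divided.\<close>

lemma prod_odd_eq_fact_quotient:
  "of_nat (\<Prod>i = 1..n. 2 * i - 1) = (fact (2 * n) / (2 ^ n * fact n) :: rat)"
proof -
  have "(\<Prod>i = 1..n. 2 * i - 1) * (2 ^ n * fact n) = fact (2 * n)"
  proof (induction n)
    case (Suc n)
    have "(\<Prod>i = 1..Suc n. 2 * i - 1) * (2 ^ Suc n * fact (Suc n)) =
        (2 * n + 2) * (2 * n + 1) * ((\<Prod>i = 1..n. 2 * i - 1) * (2 ^ n * fact n))"
      by (simp add: algebra_simps)
    also have "\<dots> = fact (2 * Suc n)" by (simp only: Suc) (simp add: algebra_simps)
    finally show ?case .
  qed simp
  then have "of_nat ((\<Prod>i = 1..n. 2 * i - 1) * (2 ^ n * fact n)) = (of_nat (fact (2 * n)) :: rat)"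
    by (simp only:)
  then show ?thesis by (simp add: eq_divide_eq del: of_nat_prod)
qed


section \<open>The defect of a marked diagram\<close>

abbreviation before :: "marking \<Rightarrow> marking \<Rightarrow> bool" where
  "before a b \<equiv> comes_before (edge_of a) (edge_of b)"

definition defect :: "marked_diagram \<Rightarrow> nat" where
  "defect D = inversions before (snd D) + length (filter (\<lambda>m. \<exists>e. m = Arrow e Leftward) (snd D))"

text \<open>Packaged as a relation so that chains of moves are elements of its reflexive transitive
  closure.\<close>

definition moves :: "nat \<Rightarrow> nat \<Rightarrow> marked_diagram rel" where
  "moves r s = {(D\<^sub>1, D\<^sub>2). D\<^sub>1 \<in> marked_diagrams r s \<and> D\<^sub>2 \<in> marked_diagrams r s \<and>
     (height_swap D\<^sub>1 D\<^sub>2 \<or> arrow_reversal D\<^sub>1 D\<^sub>2)}"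

lemma fst_moves: "(D\<^sub>1, D\<^sub>2) \<in> moves r s \<Longrightarrow> fst D\<^sub>1 = fst D\<^sub>2"
  by (auto simp: moves_def height_swap_def arrow_reversal_def)

text \<open>Being a marked diagram depends on the list only through its beads, the edges bearing
  arrows and the distinctness of edges. Both moves preserve these.\<close>

lemma marked_diagrams_move:
  assumes "D\<^sub>1 \<in> marked_diagrams r s" "height_swap D\<^sub>1 D\<^sub>2 \<or> arrow_reversal D\<^sub>1 D\<^sub>2"
  shows "(D\<^sub>1, D\<^sub>2) \<in> moves r s"
  using assms(2)
proof
  assume "height_swap D\<^sub>1 D\<^sub>2"
  then obtain E ms a b ms' where D: "D\<^sub>1 = (E, ms @ [a, b] @ ms')" "D\<^sub>2 = (E, ms @ [b, a] @ ms')"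
    by (auto simp: height_swap_def)
  have "set (ms @ [a, b] @ ms') = set (ms @ [b, a] @ ms')" by auto
  moreover have "distinct (map edge_of (ms @ [a, b] @ ms')) = distinct (map edge_of (ms @ [b, a] @ ms'))"
    by auto
  ultimately show ?thesis
    using assms unfolding moves_def marked_diagrams_def D by simp
next
  assume "arrow_reversal D\<^sub>1 D\<^sub>2"
  then obtain E ms e d d' ms' where
    D: "D\<^sub>1 = (E, ms @ [Arrow e d] @ ms')" "D\<^sub>2 = (E, ms @ [Arrow e d'] @ ms')"
    by (auto simp: arrow_reversal_def)
  have "{e'. \<exists>d. Arrow e' d \<in> set (ms @ [Arrow e c] @ ms')} =
      insert e {e'. \<exists>d. Arrow e' d \<in> set (ms @ ms')}" for c
    by auto
  then show ?thesis
    using assms unfolding moves_def marked_diagrams_def D by simp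
qed

section \<open>The total order on the markings of one diagram\<close>

context
  fixes r s E ms
  assumes D: "(E, ms) \<in> marked_diagrams r s"
begin

lemma marking_cases:
  assumes "m \<in> set ms"
  obtains "edge_of m \<in> E" "is_cup (edge_of m)" "m = Bead (edge_of m)"
  | d where "edge_of m \<in> E" "is_cap (edge_of m)" "m = Arrow (edge_of m) d"
  using D assms by (cases m) (auto simp: marked_diagrams_def)

lemma marked_edge_card: "m \<in> set ms \<Longrightarrow> card (edge_of m) = 2"
  using D by (auto elim!: marking_cases simp: marked_diagrams_def brauer_diagrams_def)

text \<open>Cups and caps are defined by inclusions, which the empty set satisfies both; an edge
  with two elements is not empty.\<close>

lemma marked_edge_not_cup_cap: "m \<in> set ms \<Longrightarrow> \<not> (is_cup (edge_of m) \<and> is_cap (edge_of m))"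
proof -
  assume "m \<in> set ms"
  then have "edge_of m \<noteq> {}" using marked_edge_card by fastforce
  then show ?thesis by (auto simp: is_cup_def is_cap_def)
qed

lemma left_vertex:
  assumes "m \<in> set ms"
  obtains v where "v \<in> edge_of m" "position v = left_position (edge_of m)"
proof -
  have "card (edge_of m) = 2" using marked_edge_card[OF assms] .
  then have "finite (edge_of m)" "edge_of m \<noteq> {}" by (auto intro: card_ge_0_finite)
  then have "left_position (edge_of m) \<in> position ` edge_of m"
    unfolding left_position_def by (intro Min_in) auto
  then show thesis using that by auto
qed

text \<open>Within one row a position determines the vertex, blocks of a partition sharing a vertex
  coincide, and no edge is marked twice.\<close>

lemma marking_eqI:
  assumes "a \<in> set ms" "b \<in> set ms" "left_position (edge_of a) = left_position (edge_of b)"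
    "is_cup (edge_of a) \<and> is_cup (edge_of b) \<or> is_cap (edge_of a) \<and> is_cap (edge_of b)"
  shows "a = b"
proof -
  obtain v where v: "v \<in> edge_of a" "position v = left_position (edge_of a)"
    using left_vertex[OF assms(1)] .
  obtain w where w: "w \<in> edge_of b" "position w = left_position (edge_of b)"
    using left_vertex[OF assms(2)] .
  have "v \<in> range Top \<and> w \<in> range Top \<or> v \<in> range Bot \<and> w \<in> range Bot"
    using v(1) w(1) assms(4) by (auto simp: is_cup_def is_cap_def)
  then have "v = w" using v(2) w(2) assms(3) by auto
  moreover have "edge_of a \<in> E" "edge_of b \<in> E" using assms(1,2) by (auto elim: marking_cases)
  ultimately have "edge_of a = edge_of b"
    using v w D by (auto simp: marked_diagrams_def brauer_diagrams_def partition_on_def disjoint_def)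
  then show ?thesis
    using D assms(1,2) by (auto simp: marked_diagrams_def distinct_map dest: inj_onD)
qed

lemma before_total: "a \<in> set ms \<Longrightarrow> b \<in> set ms \<Longrightarrow> a \<noteq> b \<Longrightarrow> before a b \<or> before b a"
proof -
  assume ab: "a \<in> set ms" "b \<in> set ms" "a \<noteq> b"
  have "is_cup (edge_of m) \<or> is_cap (edge_of m)" if "m \<in> set ms" for m
    using that by (auto elim: marking_cases)
  then show ?thesis using ab marking_eqI[of a b] unfolding comes_before_def by (metis neq_iff)
qed

lemma before_asym: "a \<in> set ms \<Longrightarrow> b \<in> set ms \<Longrightarrow> before a b \<Longrightarrow> \<not> before b a"
  using marked_edge_not_cup_cap[of a] marked_edge_not_cup_cap[of b]
  unfolding comes_before_def by auto

lemma before_trans: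
  "a \<in> set ms \<Longrightarrow> b \<in> set ms \<Longrightarrow> c \<in> set ms \<Longrightarrow> before a b \<Longrightarrow> before b c \<Longrightarrow> before a c"
  using marked_edge_not_cup_cap[of a] marked_edge_not_cup_cap[of b] marked_edge_not_cup_cap[of c]
  unfolding comes_before_def by auto

lemma distinct_markings: "distinct ms"
  using D by (auto simp: marked_diagrams_def distinct_map)

text \<open>Each condition of standardness is the vanishing of one summand of the defect.\<close>

lemma standard_iff_defect: "standard (E, ms) \<longleftrightarrow> defect (E, ms) = 0"
proof -
  have "(\<forall>e d. Arrow e d \<in> set ms \<longrightarrow> d = Rightward) \<longleftrightarrow>
      filter (\<lambda>m. \<exists>e. m = Arrow e Leftward) ms = []"
    using direction.exhaust by (auto simp: filter_empty_conv)
  moreover have "(\<forall>i < length ms. \<forall>j < length ms. before (ms ! i) (ms ! j) \<longrightarrow> i < j) \<longleftrightarrow>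
      inversions before ms = 0"
  proof
    assume S: "\<forall>i < length ms. \<forall>j < length ms. before (ms ! i) (ms ! j) \<longrightarrow> i < j"
    have "\<not> before (ms ! j) (ms ! i)" if "i < j" "j < length ms" for i j
    proof
      assume "before (ms ! j) (ms ! i)"
      then have "j < i" using S that by simp
      then show False using \<open>i < j\<close> by simp
    qed
    then show "inversions before ms = 0"
      unfolding inversions_eq_0_iff sorted_wrt_iff_nth_less by simp
  next
    assume "inversions before ms = 0"
    then have S: "sorted_wrt (\<lambda>x y. \<not> before y x) ms" by (simp only: inversions_eq_0_iff)
    show "\<forall>i < length ms. \<forall>j < length ms. before (ms ! i) (ms ! j) \<longrightarrow> i < j"
    proof (intro allI impI)
      fix i j assume ij: "i < length ms" "j < length ms" "before (ms ! i) (ms ! j)"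
      have "\<not> j < i" using sorted_wrt_nth_less[OF S, of j i] ij by blast
      moreover have "i \<noteq> j" using before_asym[of "ms ! i" "ms ! i"] ij by force
      ultimately show "i < j" by simp
    qed
  qed
  ultimately show ?thesis unfolding standard_def defect_def by auto
qed

text \<open>Absence of inversions only says that no later marking precedes an earlier one; totality
  on distinct markings turns this into strict sortedness.\<close>

lemma sorted_wrt_before:
  assumes "standard (E, ms)"
  shows "sorted_wrt before ms"
  unfolding sorted_wrt_iff_nth_less
proof (intro allI impI)
  fix i j assume ij: "i < j" "j < length ms"
  have "sorted_wrt (\<lambda>x y. \<not> before y x) ms"
    using assms by (simp add: standard_iff_defect defect_def inversions_eq_0_iff)
  then have "\<not> before (ms ! j) (ms ! i)" using ij sorted_wrt_nth_less by fastforce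
  moreover have "ms ! i \<noteq> ms ! j" using ij distinct_markings by (simp add: nth_eq_iff_index_eq)
  ultimately show "before (ms ! i) (ms ! j)" using before_total[of "ms ! i" "ms ! j"] ij by auto
qed

text \<open>An arrow pointing left can be reversed. If there is none, the list is unsorted, so some
  adjacent pair is out of order and can be swapped.\<close>

lemma ex_move_less_defect:
  assumes "defect (E, ms) \<noteq> 0"
  shows "\<exists>D'. ((E, ms), D') \<in> moves r s \<and> defect D' < defect (E, ms)"
proof (cases "\<exists>e. Arrow e Leftward \<in> set ms")
  case True
  then obtain e ms1 ms2 where ms: "ms = ms1 @ [Arrow e Leftward] @ ms2"
    using split_list by fastforce
  let ?D' = "(E, ms1 @ [Arrow e Rightward] @ ms2)"
  have "arrow_reversal (E, ms) ?D'" unfolding arrow_reversal_def ms by blast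
  moreover have "inversions before (snd ?D') = inversions before ms"
    using inversions_map[of comes_before edge_of "snd ?D'"] inversions_map[of comes_before edge_of ms]
    by (simp add: ms)
  then have "defect ?D' < defect (E, ms)" by (simp add: defect_def ms)
  ultimately show ?thesis using marked_diagrams_move[OF D] by blast
next
  case False
  then have "\<not> sorted_wrt (\<lambda>x y. \<not> before y x) ms"
    using assms inversions_eq_0_iff[of before ms] by (auto simp: defect_def filter_empty_conv)
  \<comment> \<open>For distinct markings, failure of \<open>before\<close> means
    \<open>before\<close> in the other direction, so the negated relation inherits transitivity. A
    list without adjacent inversions thus has none at all.\<close>
  moreover have "successively (\<lambda>x y. \<not> before y x) ms \<longleftrightarrow> sorted_wrt (\<lambda>x y. \<not> before y x) ms"
  proof (rule successively_iff_sorted_wrt_strong)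
    fix a b c
    assume *: "a \<in> set ms" "b \<in> set ms" "c \<in> set ms" "\<not> before b a" "\<not> before c b"
    show "\<not> before c a"
    proof
      assume "before c a"
      have "a \<noteq> b" "b \<noteq> c" using * \<open>before c a\<close> by auto
      then have "before a b" "before b c"
        using before_total[of a b] before_total[of b c] * by simp_all
      then have "before a c" using before_trans[of a b c] * by simp
      then show False using before_asym[of a c] * \<open>before c a\<close> by simp
    qed
  qed
  ultimately have "\<not> successively (\<lambda>x y. \<not> before y x) ms" by simp
  then obtain ms1 a b ms2 where ms: "ms = ms1 @ [a, b] @ ms2" "\<not> \<not> before b a"
    by (rule not_successively_split)
  let ?D' = "(E, ms1 @ [b, a] @ ms2)"
  have "height_swap (E, ms) ?D'" unfolding height_swap_def ms by blast
  moreover have "\<not> before a b" using before_asym[of b a] ms by simp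
  then have "defect ?D' < defect (E, ms)"
    using inversions_swap[of before b a ms1 ms2] ms by (simp add: defect_def)
  ultimately show ?thesis using marked_diagrams_move[OF D] by blast
qed

end

text \<open>A swap affects only the order of two distinct markings, which are comparable in exactly
  one direction. A reversal keeps all edges in place and changes the number of left arrows by
  one.\<close>

lemma defect_move:
  assumes "(D\<^sub>1, D\<^sub>2) \<in> moves r s"
  shows "defect D\<^sub>1 = Suc (defect D\<^sub>2) \<or> defect D\<^sub>2 = Suc (defect D\<^sub>1)"
proof -
  have D1: "D\<^sub>1 \<in> marked_diagrams r s" and "height_swap D\<^sub>1 D\<^sub>2 \<or> arrow_reversal D\<^sub>1 D\<^sub>2"
    using assms by (auto simp: moves_def)
  from this(2) show ?thesis
  proof
    assume "height_swap D\<^sub>1 D\<^sub>2"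
    then obtain E ms a b ms' where D: "D\<^sub>1 = (E, ms @ [a, b] @ ms')" "D\<^sub>2 = (E, ms @ [b, a] @ ms')"
      by (auto simp: height_swap_def)
    have "a \<noteq> b" using distinct_markings D1 D by fastforce
    then consider "before a b" "\<not> before b a" | "before b a" "\<not> before a b"
      using before_total[of E "ms @ [a, b] @ ms'" r s a b]
        before_asym[of E "ms @ [a, b] @ ms'" r s a b] D1 D by auto
    then show ?thesis
      by cases (use inversions_swap[of before a b] inversions_swap[of before b a] D
        in \<open>auto simp: defect_def\<close>)
  next
    assume "arrow_reversal D\<^sub>1 D\<^sub>2"
    then obtain E ms e d d' ms' where "d \<noteq> d'" and
      D: "D\<^sub>1 = (E, ms @ [Arrow e d] @ ms')" "D\<^sub>2 = (E, ms @ [Arrow e d'] @ ms')"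
      by (auto simp: arrow_reversal_def)
    have "inversions before (snd D\<^sub>1) = inversions before (snd D\<^sub>2)"
      using inversions_map[of comes_before edge_of "snd D\<^sub>1"]
        inversions_map[of comes_before edge_of "snd D\<^sub>2"] by (simp add: D)
    then show ?thesis using \<open>d \<noteq> d'\<close> by (cases d; cases d') (auto simp: defect_def D)
  qed
qed

section \<open>Existence and uniqueness of the standard marking of a Brauer diagram\<close>

lemma standard_diagram_defect: "D \<in> standard_diagrams r s \<longleftrightarrow> D \<in> marked_diagrams r s \<and> defect D = 0"
  using standard_iff_defect by (cases D) (auto simp: standard_diagrams_def)

text \<open>Descent on the defect, which some move lowers as long as it is positive.\<close>

lemma moves_to_standard:
  assumes "D \<in> marked_diagrams r s"
  obtains D' where "D' \<in> standard_diagrams r s" "(D, D') \<in> (moves r s)\<^sup>*"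
proof -
  have "\<exists>D'\<in>standard_diagrams r s. (D, D') \<in> (moves r s)\<^sup>*"
    using assms
  proof (induction "defect D" arbitrary: D rule: less_induct)
    case less
    show ?case
    proof (cases "defect D = 0")
      case True
      then show ?thesis using less.prems standard_diagram_defect by blast
    next
      case False
      obtain D' where D': "(D, D') \<in> moves r s" "defect D' < defect D"
        using ex_move_less_defect[of "fst D" "snd D" r s] less.prems False by auto
      then have "D' \<in> marked_diagrams r s" by (simp add: moves_def)
      then show ?thesis using less.hyps[OF D'(2)] D'(1) by (meson converse_rtrancl_into_rtrancl)
    qed
  qed
  then show thesis using that by blast
qed

text \<open>The underlying diagram forces the set of markings, namely beads on cups and right arrows
  on caps, and sortedness then forces their order.\<close>

lemma inj_on_standard: "inj_on fst (standard_diagrams r s)"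
proof (rule inj_onI)
  fix D D' assume DD: "D \<in> standard_diagrams r s" "D' \<in> standard_diagrams r s" "fst D = fst D'"
  then obtain E ms ms' where D: "D = (E, ms)" "D' = (E, ms')" by (cases D; cases D') auto
  have M: "(E, ms) \<in> marked_diagrams r s" "(E, ms') \<in> marked_diagrams r s"
    and S: "standard (E, ms)" "standard (E, ms')"
    using DD D by (auto simp: standard_diagrams_def)
  have set_eq: "set ns = Bead ` {e \<in> E. is_cup e} \<union> (\<lambda>e. Arrow e Rightward) ` {e \<in> E. is_cap e}"
    if "(E, ns) \<in> marked_diagrams r s" "standard (E, ns)" for ns
  proof -
    have bead: "Bead e \<in> set ns \<longleftrightarrow> e \<in> E \<and> is_cup e"
      and arrow: "(\<exists>d. Arrow e d \<in> set ns) \<longleftrightarrow> e \<in> E \<and> is_cap e" for e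
      using that(1) unfolding marked_diagrams_def by auto
    have right: "Arrow e d \<in> set ns \<Longrightarrow> d = Rightward" for e d
      using that(2) unfolding standard_def by auto
    have "m \<in> set ns \<longleftrightarrow> m \<in> Bead ` {e \<in> E. is_cup e} \<union> (\<lambda>e. Arrow e Rightward) ` {e \<in> E. is_cap e}"
      for m
    proof (cases m)
      case (Bead e)
      then show ?thesis using bead[of e] by auto
    next
      case (Arrow e d)
      then show ?thesis using arrow[of e] right by auto
    qed
    then show ?thesis by blast
  qed
  have "ms = ms'"
  proof (rule sorted_wrt_distinct_set_unique)
    show "sorted_wrt before ms" "sorted_wrt before ms'" using M S sorted_wrt_before by blast+
    show "distinct ms" "distinct ms'" using M distinct_markings by blast+
    show "set ms = set ms'" using M S set_eq by simp
    show "a = b" if "a \<in> set ms" "b \<in> set ms" "before a b" "before b a" for a b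
      using before_asym[OF M(1)] that by blast
  qed
  then show "D = D'" using D by simp
qed

text \<open>Every Brauer diagram can be marked in an arbitrary order; moving this marking to a
  standard one leaves the underlying diagram unchanged.\<close>

lemma standard_diagrams_fst: "fst ` standard_diagrams r s = brauer_diagrams r s"
proof
  show "brauer_diagrams r s \<subseteq> fst ` standard_diagrams r s"
  proof
    fix E assume E: "E \<in> brauer_diagrams r s"
    then have part: "partition_on (vertices r s) E" and two: "\<forall>e\<in>E. card e = 2"
      by (auto simp: brauer_diagrams_def)
    have "finite E" using finite_elements[OF _ part] by (simp add: vertices_def)
    let ?M = "Bead ` {e \<in> E. is_cup e} \<union> (\<lambda>e. Arrow e Rightward) ` {e \<in> E. is_cap e}"
    have "finite ?M" using \<open>finite E\<close> by simp
    then obtain ms where ms: "set ms = ?M" "distinct ms" using finite_distinct_list[of ?M] by metis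
    have "\<not> (is_cup e \<and> is_cap e)" if "e \<in> E" for e
    proof -
      have "e \<noteq> {}" using two that by force
      then show ?thesis by (auto simp: is_cup_def is_cap_def)
    qed
    then have "inj_on edge_of ?M" by (auto simp: inj_on_def)
    then have "(E, ms) \<in> marked_diagrams r s"
      using E ms by (auto simp: marked_diagrams_def distinct_map)
    then obtain D' where D': "D' \<in> standard_diagrams r s" "((E, ms), D') \<in> (moves r s)\<^sup>*"
      using moves_to_standard by blast
    from D'(2) have "fst D' = fst (E, ms)"
      by (induction rule: rtrancl_induct) (auto dest: fst_moves)
    then show "E \<in> fst ` standard_diagrams r s" using D'(1) by force
  qed
qed (auto simp: standard_diagrams_def marked_diagrams_def)

section \<open>Signs and the standard basis\<close>

text \<open>For a Brauer diagram \<open>E\<close> and a sign \<open>\<epsilon>\<close>, this is the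
  coordinate at the standard marking of \<open>E\<close>, written on representatives in the free
  space.\<close>

definition sign_functional ::
    "('k, 'm) ring_scheme \<Rightarrow> nat \<Rightarrow> nat \<Rightarrow> 'k \<Rightarrow> edge set \<Rightarrow> (marked_diagram \<Rightarrow> 'k) \<Rightarrow> 'k" where
  "sign_functional K r s \<epsilon> E f =
     (\<Oplus>\<^bsub>K\<^esub>D\<in>{D \<in> marked_diagrams r s. fst D = E}. \<epsilon> [^]\<^bsub>K\<^esub> defect D \<otimes>\<^bsub>K\<^esub> f D)"

context
  fixes K :: "('k, 'm) ring_scheme" (structure)
    and r s :: nat
    and \<epsilon> \<delta> :: 'k
  assumes K: "field K" and \<epsilon>: "\<epsilon> \<in> carrier K" and \<epsilon>_square: "\<epsilon> \<otimes> \<epsilon> = \<one>"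
begin

interpretation K: field K by (rule K)

interpretation F: Module.module K "free_space K r s" by (rule free_space_module[OF K \<epsilon>])

interpretation V: vectorspace K "brauer_space K r s \<delta> \<epsilon>"
  by (rule brauer_space_vectorspace[OF K \<epsilon>])

interpretation N: submodule K "relation_space K r s \<epsilon>" "free_space K r s"
  by (rule relation_space_submodule[OF K \<epsilon>])

interpretation Q: mod_hom K "free_space K r s" "brauer_space K r s \<delta> \<epsilon>"
    "\<lambda>f. relation_space K r s \<epsilon> +>\<^bsub>free_space K r s\<^esub> f"
  unfolding brauer_space_def by (intro quotient_module_module N.submodule_axioms)

abbreviation (input) \<phi> where "\<phi> \<equiv> sign_functional K r s \<epsilon>"

section \<open>Linearity of the sign functionals and their vanishing on the relations\<close>

lemma in_free_space: "f \<in> carrier (free_space K r s) \<Longrightarrow> D \<in> marked_diagrams r s \<Longrightarrow> f D \<in> carrier K"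
  by (auto simp: free_space_def K.func_space_def)

lemma sign_functional_closed:
  "f \<in> carrier (free_space K r s) \<Longrightarrow> \<phi> E f \<in> carrier K"
  unfolding sign_functional_def using \<epsilon> in_free_space by (intro K.finsum_closed) auto

lemma sign_functional_add:
  assumes "f \<in> carrier (free_space K r s)" "g \<in> carrier (free_space K r s)"
  shows "\<phi> E (f \<oplus>\<^bsub>free_space K r s\<^esub> g) = \<phi> E f \<oplus> \<phi> E g"
proof -
  have "\<phi> E (f \<oplus>\<^bsub>free_space K r s\<^esub> g) = (\<Oplus>D\<in>{D \<in> marked_diagrams r s. fst D = E}.
      \<epsilon> [^] defect D \<otimes> f D \<oplus> \<epsilon> [^] defect D \<otimes> g D)"
    unfolding sign_functional_def using assms \<epsilon> in_free_space
    by (intro K.finsum_cong') (auto simp: free_space_def K.func_space_def K.r_distr Pi_iff)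
  also have "\<dots> = \<phi> E f \<oplus> \<phi> E g"
    unfolding sign_functional_def using assms \<epsilon> in_free_space by (intro K.finsum_addf) auto
  finally show ?thesis .
qed

lemma sign_functional_smult:
  assumes "c \<in> carrier K" "f \<in> carrier (free_space K r s)"
  shows "\<phi> E (c \<odot>\<^bsub>free_space K r s\<^esub> f) = c \<otimes> \<phi> E f"
proof -
  have "\<phi> E (c \<odot>\<^bsub>free_space K r s\<^esub> f) = (\<Oplus>D\<in>{D \<in> marked_diagrams r s. fst D = E}.
      c \<otimes> (\<epsilon> [^] defect D \<otimes> f D))"
    unfolding sign_functional_def using assms \<epsilon> in_free_space
    by (intro K.finsum_cong') (auto simp: free_space_def K.func_space_def K.m_lcomm Pi_iff)
  also have "\<dots> = c \<otimes> \<phi> E f"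
    unfolding sign_functional_def using assms \<epsilon> in_free_space finite_marked_diagrams
    by (intro K.finsum_rdistr[symmetric]) auto
  finally show ?thesis .
qed

lemma sign_functional_generator:
  assumes "D \<in> marked_diagrams r s"
  shows "\<phi> E (generator K r s D) = (if fst D = E then \<epsilon> [^] defect D else \<zero>)"
proof -
  let ?A = "{D \<in> marked_diagrams r s. fst D = E}"
  have "\<phi> E (generator K r s D) = (\<Oplus>D'\<in>?A. if D = D' then \<epsilon> [^] defect D' else \<zero>)"
    unfolding sign_functional_def using \<epsilon> by (intro K.finsum_cong') (auto simp: generator_def)
  also have "\<dots> = (if fst D = E then \<epsilon> [^] defect D else \<zero>)"
  proof (cases "fst D = E")
    case True
    then show ?thesis
      using assms \<epsilon> finite_marked_diagrams[of r s]
        K.finsum_singleton[of D ?A "\<lambda>D. \<epsilon> [^] defect D"]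
      by simp
  next
    case False
    then have "(\<Oplus>D'\<in>?A. if D = D' then \<epsilon> [^] defect D' else \<zero>) = (\<Oplus>D'\<in>?A. \<zero>)"
      by (intro K.finsum_cong') auto
    then show ?thesis using False by simp
  qed
  finally show ?thesis .
qed

text \<open>Since \<open>\<epsilon>\<close> is its own inverse, raising and lowering the defect by
  one both multiply the sign by \<open>\<epsilon>\<close>.\<close>

lemma sign_move:
  assumes "(D\<^sub>1, D\<^sub>2) \<in> moves r s"
  shows "\<epsilon> [^] defect D\<^sub>1 = \<epsilon> \<otimes> \<epsilon> [^] defect D\<^sub>2"
proof -
  have Suc: "\<epsilon> [^] Suc n = \<epsilon> \<otimes> \<epsilon> [^] n" for n :: nat
    using \<epsilon> by (simp add: K.m_comm)
  have "\<epsilon> \<otimes> \<epsilon> [^] Suc n = \<epsilon> [^] n" for n :: nat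
  proof -
    have "\<epsilon> \<otimes> \<epsilon> [^] Suc n = (\<epsilon> \<otimes> \<epsilon>) \<otimes> \<epsilon> [^] n"
      unfolding Suc using \<epsilon> by (simp only: K.m_assoc K.nat_pow_closed)
    then show ?thesis using \<epsilon> by (simp add: \<epsilon>_square)
  qed
  then show ?thesis using defect_move[OF assms] Suc by auto
qed

lemma sign_functional_kernel_submodule:
  "submodule K {f \<in> carrier (free_space K r s). \<phi> E f = \<zero>} (free_space K r s)"
proof (rule submodule.intro)
  \<comment> \<open>The zero vector is written as a zero multiple of itself, so that homogeneity
    yields the value zero.\<close>
  have "\<phi> E (\<zero> \<odot>\<^bsub>free_space K r s\<^esub> \<zero>\<^bsub>free_space K r s\<^esub>) = \<zero> \<otimes> \<phi> E \<zero>\<^bsub>free_space K r s\<^esub>"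
    by (rule sign_functional_smult) auto
  then show "\<zero>\<^bsub>free_space K r s\<^esub> \<in> {f \<in> carrier (free_space K r s). \<phi> E f = \<zero>}"
    by (simp add: sign_functional_closed)
qed (use F.module_axioms sign_functional_add sign_functional_smult in auto)

lemma relator:
  assumes "R \<in> relators K r s \<epsilon>"
  obtains D\<^sub>1 D\<^sub>2 where "(D\<^sub>1, D\<^sub>2) \<in> moves r s" "R \<in> carrier (free_space K r s)"
    "R = generator K r s D\<^sub>1 \<ominus>\<^bsub>free_space K r s\<^esub> \<epsilon> \<odot>\<^bsub>free_space K r s\<^esub> generator K r s D\<^sub>2"
proof -
  obtain D\<^sub>1 D\<^sub>2 where "(D\<^sub>1, D\<^sub>2) \<in> moves r s"
    and "R = generator K r s D\<^sub>1 \<ominus>\<^bsub>free_space K r s\<^esub> \<epsilon> \<odot>\<^bsub>free_space K r s\<^esub> generator K r s D\<^sub>2"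
    using assms unfolding relators_def moves_def by blast
  moreover from this(2) have "R \<in> carrier (free_space K r s)"
    using generator_closed[OF K \<epsilon>] \<epsilon> by (simp add: F.M.minus_closed)
  ultimately show thesis using that by blast
qed

text \<open>Replaces the subtraction in a relator by an addition, to which additivity and the
  description of cosets apply directly.\<close>

lemma add_relator:
  "generator K r s D\<^sub>1 = (generator K r s D\<^sub>1 \<ominus>\<^bsub>free_space K r s\<^esub> \<epsilon> \<odot>\<^bsub>free_space K r s\<^esub> generator K r s D\<^sub>2)
     \<oplus>\<^bsub>free_space K r s\<^esub> \<epsilon> \<odot>\<^bsub>free_space K r s\<^esub> generator K r s D\<^sub>2"
  using generator_closed[OF K \<epsilon>] \<epsilon> by (simp add: F.M.minus_eq F.M.a_assoc F.M.l_neg)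

text \<open>A move keeps the underlying diagram and multiplies the sign by
  \<open>\<epsilon>\<close>, so the two terms of a relator cancel under the functional; the kernel
  is a submodule and so contains their span.\<close>

lemma relation_space_subset_kernel:
  "relation_space K r s \<epsilon> \<subseteq> {f \<in> carrier (free_space K r s). \<phi> E f = \<zero>}"
  unfolding relation_space_def
proof (rule F.span_is_subset[OF _ sign_functional_kernel_submodule], rule subsetI)
  fix R assume "R \<in> relators K r s \<epsilon>"
  then obtain D\<^sub>1 D\<^sub>2 where D: "(D\<^sub>1, D\<^sub>2) \<in> moves r s" and R: "R \<in> carrier (free_space K r s)"
    "R = generator K r s D\<^sub>1 \<ominus>\<^bsub>free_space K r s\<^esub> \<epsilon> \<odot>\<^bsub>free_space K r s\<^esub> generator K r s D\<^sub>2"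
    by (rule relator)
  have M: "D\<^sub>1 \<in> marked_diagrams r s" "D\<^sub>2 \<in> marked_diagrams r s" using D by (auto simp: moves_def)
  have gens: "\<phi> E (generator K r s D\<^sub>1) = \<epsilon> \<otimes> \<phi> E (generator K r s D\<^sub>2)"
    using sign_move[OF D] fst_moves[OF D] M \<epsilon> by (simp add: sign_functional_generator)
  have "\<phi> E (generator K r s D\<^sub>1) = \<phi> E (R \<oplus>\<^bsub>free_space K r s\<^esub> \<epsilon> \<odot>\<^bsub>free_space K r s\<^esub> generator K r s D\<^sub>2)"
    using add_relator R(2) by simp
  also have "\<dots> = \<phi> E R \<oplus> \<epsilon> \<otimes> \<phi> E (generator K r s D\<^sub>2)"
    using R(1) \<epsilon> generator_closed[OF K \<epsilon>]
    by (simp add: sign_functional_add sign_functional_smult)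
  finally have "\<phi> E R \<oplus> \<epsilon> \<otimes> \<phi> E (generator K r s D\<^sub>2) = \<epsilon> \<otimes> \<phi> E (generator K r s D\<^sub>2)"
    using gens by simp
  then have "\<phi> E R = \<zero>"
    using R(1) \<epsilon> generator_closed[OF K \<epsilon>] by (simp add: sign_functional_closed)
  then show "R \<in> {f \<in> carrier (free_space K r s). \<phi> E f = \<zero>}" using R(1) by simp
qed

text \<open>Vanishing on the relation space makes the functional constant on cosets. This serves as
  its descent to the quotient.\<close>

lemma sign_functional_coset:
  assumes "f \<in> carrier (free_space K r s)"
    and "diagram_class K r s \<delta> \<epsilon> D = relation_space K r s \<epsilon> +>\<^bsub>free_space K r s\<^esub> f"
  shows "\<phi> E (generator K r s D) = \<phi> E f"
proof -
  have "generator K r s D = \<zero>\<^bsub>free_space K r s\<^esub> \<oplus>\<^bsub>free_space K r s\<^esub> generator K r s D"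
    using generator_closed[OF K \<epsilon>] by simp
  then have "generator K r s D \<in> diagram_class K r s \<delta> \<epsilon> D"
    unfolding diagram_class_def a_r_coset_def' using N.zero_closed by blast
  then obtain n where n: "n \<in> relation_space K r s \<epsilon>" "generator K r s D = n \<oplus>\<^bsub>free_space K r s\<^esub> f"
    using assms(2) by (auto simp: a_r_coset_def')
  then show ?thesis
    using assms(1) relation_space_subset_kernel[of E]
    by (auto simp: sign_functional_add sign_functional_closed)
qed

section \<open>Duality with the standard diagrams and linear independence\<close>

lemma sign_functional_standard:
  assumes "D \<in> standard_diagrams r s"
  shows "\<phi> E (generator K r s D) = (if fst D = E then \<one> else \<zero>)"
  using assms by (simp add: standard_diagram_defect sign_functional_generator)

text \<open>The functional of \<open>fst D\<close> is \<open>\<one>\<close> on the first generator,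
  hence on the second, so both standard diagrams have the same underlying diagram and agree.\<close>

lemma inj_on_diagram_class: "inj_on (diagram_class K r s \<delta> \<epsilon>) (standard_diagrams r s)"
proof (rule inj_onI)
  fix D D' assume D: "D \<in> standard_diagrams r s" "D' \<in> standard_diagrams r s"
    "diagram_class K r s \<delta> \<epsilon> D = diagram_class K r s \<delta> \<epsilon> D'"
  have "\<phi> (fst D) (generator K r s D) = \<phi> (fst D) (generator K r s D')"
    using D(3) generator_closed[OF K \<epsilon>]
    by (intro sign_functional_coset) (auto simp: diagram_class_def)
  then have "fst D = fst D'" using D(1,2) by (auto simp: sign_functional_standard split: if_splits)
  then show "D = D'" using inj_on_standard D(1,2) by (auto dest: inj_onD)
qed

text \<open>This image stands for the kernel of the induced functional on the quotient.\<close>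

lemma submodule_image_kernel:
  "submodule K ((\<lambda>f. relation_space K r s \<epsilon> +>\<^bsub>free_space K r s\<^esub> f) `
     {f \<in> carrier (free_space K r s). \<phi> E f = \<zero>}) (brauer_space K r s \<delta> \<epsilon>)"
    (is "submodule K (?q ` ?ker) ?V")
proof -
  interpret Ker: submodule K ?ker "free_space K r s" by (rule sign_functional_kernel_submodule)
  show ?thesis
  proof (rule submodule.intro)
    fix X Y assume "X \<in> ?q ` ?ker" "Y \<in> ?q ` ?ker"
    then obtain f g where fg: "f \<in> ?ker" "g \<in> ?ker" "X = ?q f" "Y = ?q g" by blast
    then have "X \<oplus>\<^bsub>?V\<^esub> Y = ?q (f \<oplus>\<^bsub>free_space K r s\<^esub> g)" by simp
    then show "X \<oplus>\<^bsub>?V\<^esub> Y \<in> ?q ` ?ker" using Ker.m_closed[OF fg(1,2)] by (rule image_eqI)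
  next
    show "\<zero>\<^bsub>?V\<^esub> \<in> ?q ` ?ker"
      by (rule image_eqI[of _ ?q "\<zero>\<^bsub>free_space K r s\<^esub>"]) (use Ker.zero_closed Q.f0_is_0 in simp_all)
  next
    fix c X assume c: "c \<in> carrier K" and "X \<in> ?q ` ?ker"
    then obtain f where f: "f \<in> ?ker" "X = ?q f" by blast
    then have "c \<odot>\<^bsub>?V\<^esub> X = ?q (c \<odot>\<^bsub>free_space K r s\<^esub> f)" using c by simp
    then show "c \<odot>\<^bsub>?V\<^esub> X \<in> ?q ` ?ker" using Ker.smult_closed[OF c f(1)] by (rule image_eqI)
  qed (use V.module_axioms Q.f_im in auto)
qed

lemma finite_standard_diagrams: "finite (standard_diagrams r s)"
  using finite_marked_diagrams[of r s] by (simp add: standard_diagrams_def)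

text \<open>In a dependent set some class lies in the span of the others. The functional of its
  underlying diagram kills the others but takes the value \<open>\<one>\<close> on it.\<close>

lemma standard_classes_independent:
  "V.lin_indpt (diagram_class K r s \<delta> \<epsilon> ` standard_diagrams r s)"
proof
  let ?S = "diagram_class K r s \<delta> \<epsilon> ` standard_diagrams r s"
  let ?q = "\<lambda>f. relation_space K r s \<epsilon> +>\<^bsub>free_space K r s\<^esub> f"
  assume "V.lin_dep ?S"
  moreover have "?S \<subseteq> carrier (brauer_space K r s \<delta> \<epsilon>)"
    using diagram_class_closed[OF K \<epsilon>] by blast
  moreover have "finite ?S" using finite_standard_diagrams by simp
  ultimately obtain D where D: "D \<in> standard_diagrams r s"
    and span: "diagram_class K r s \<delta> \<epsilon> D \<in> V.span (?S - {diagram_class K r s \<delta> \<epsilon> D})"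
    using V.lindep_span by auto
  let ?ker = "{f \<in> carrier (free_space K r s). \<phi> (fst D) f = \<zero>}"
  have "?S - {diagram_class K r s \<delta> \<epsilon> D} \<subseteq> ?q ` ?ker"
  proof
    fix X assume "X \<in> ?S - {diagram_class K r s \<delta> \<epsilon> D}"
    then obtain D' where D': "D' \<in> standard_diagrams r s" "X = diagram_class K r s \<delta> \<epsilon> D'" "D' \<noteq> D"
      by blast
    then have "fst D' \<noteq> fst D" using inj_on_standard D by (auto dest: inj_onD)
    then have "generator K r s D' \<in> ?ker"
      using D'(1) generator_closed[OF K \<epsilon>] by (simp add: sign_functional_standard)
    then show "X \<in> ?q ` ?ker" using D'(2) unfolding diagram_class_def by blast
  qed
  then have "V.span (?S - {diagram_class K r s \<delta> \<epsilon> D}) \<subseteq> ?q ` ?ker"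
    by (rule V.span_is_subset[OF _ submodule_image_kernel])
  with span obtain f where f: "f \<in> ?ker" "diagram_class K r s \<delta> \<epsilon> D = ?q f" by blast
  then have "\<phi> (fst D) (generator K r s D) = \<zero>"
    using sign_functional_coset[of f D "fst D"] by simp
  then show False using D by (simp add: sign_functional_standard)
qed

section \<open>The standard classes span the quotient\<close>

lemma diagram_class_move:
  assumes "(D\<^sub>1, D\<^sub>2) \<in> moves r s"
  shows "diagram_class K r s \<delta> \<epsilon> D\<^sub>1 = \<epsilon> \<odot>\<^bsub>brauer_space K r s \<delta> \<epsilon>\<^esub> diagram_class K r s \<delta> \<epsilon> D\<^sub>2"
proof -
  let ?F = "free_space K r s" and ?N = "relation_space K r s \<epsilon>"
  let ?R = "generator K r s D\<^sub>1 \<ominus>\<^bsub>?F\<^esub> \<epsilon> \<odot>\<^bsub>?F\<^esub> generator K r s D\<^sub>2"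
  have "relators K r s \<epsilon> \<subseteq> carrier ?F" by (auto elim: relator)
  moreover have "?R \<in> relators K r s \<epsilon>" using assms unfolding relators_def moves_def by blast
  \<comment> \<open>The difference of the two vectors is a relation, so they represent the same
    coset.\<close>
  ultimately have "?R \<in> ?N" unfolding relation_space_def using F.in_own_span by blast
  then have "generator K r s D\<^sub>1 \<in> ?N +>\<^bsub>?F\<^esub> (\<epsilon> \<odot>\<^bsub>?F\<^esub> generator K r s D\<^sub>2)"
    unfolding a_r_coset_def' using add_relator by blast
  \<comment> \<open>Closure under negation comes from the scalar \<open>\<ominus> \<one>\<close>; it
    makes the relation space the subgroup needed for changing coset representatives.\<close>
  moreover have "\<ominus>\<^bsub>?F\<^esub> x \<in> ?N" if "x \<in> ?N" for x
    using N.smult_closed[OF _ that, of "\<ominus> \<one>"] subsetD[OF N.subset that] F.smult_l_minus[of \<one> x]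
    by simp
  then have "subgroup ?N (add_monoid ?F)"
    by (intro subgroup.intro) (use N.subset in \<open>auto simp: a_inv_def\<close>)
  ultimately have "?N +>\<^bsub>?F\<^esub> (\<epsilon> \<odot>\<^bsub>?F\<^esub> generator K r s D\<^sub>2) = ?N +>\<^bsub>?F\<^esub> generator K r s D\<^sub>1"
    by (intro F.M.a_repr_independence F.smult_closed generator_closed[OF K \<epsilon>] \<epsilon>)
  then show ?thesis
    unfolding diagram_class_def using generator_closed[OF K \<epsilon>] \<epsilon> by simp
qed

text \<open>Along a chain of moves each class is an \<open>\<epsilon>\<close>-multiple of the next
  and the last is standard, so the span contains the classes of all marked diagrams.\<close>

lemma span_standard_classes:
  "V.span (diagram_class K r s \<delta> \<epsilon> ` standard_diagrams r s) = carrier (brauer_space K r s \<delta> \<epsilon>)"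
proof -
  let ?S = "diagram_class K r s \<delta> \<epsilon> ` standard_diagrams r s"
  have S: "?S \<subseteq> carrier (brauer_space K r s \<delta> \<epsilon>)"
    using diagram_class_closed[OF K \<epsilon>] by blast
  have sub: "submodule K (V.span ?S) (brauer_space K r s \<delta> \<epsilon>)"
    by (rule V.span_is_submodule[OF S])
  have "diagram_class K r s \<delta> \<epsilon> D \<in> V.span ?S" if D: "D \<in> marked_diagrams r s" for D
  proof -
    obtain D' where D': "D' \<in> standard_diagrams r s" "(D, D') \<in> (moves r s)\<^sup>*"
      using moves_to_standard[OF D] .
    from D'(2) show ?thesis
    proof (induction rule: converse_rtrancl_induct)
      case base
      then show ?case using V.in_own_span[OF S] D'(1) by blast
    next
      case (step D\<^sub>1 D\<^sub>2)
      then show ?case using diagram_class_move submodule.smult_closed[OF sub \<epsilon>] by simp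
    qed
  qed
  then have "V.span (diagram_class K r s \<delta> \<epsilon> ` marked_diagrams r s) \<subseteq> V.span ?S"
    by (intro V.span_is_subset[OF _ sub]) blast
  then show ?thesis
    using span_diagram_classes[OF K \<epsilon>] V.span_is_subset2[OF S] by auto
qed

section \<open>The homogeneous basis and the dimension\<close>

lemma standard_classes_basis:
  "V.basis (diagram_class K r s \<delta> \<epsilon> ` standard_diagrams r s)"
  unfolding V.basis_def
  using standard_classes_independent span_standard_classes diagram_class_closed[OF K \<epsilon>] by blast

lemma diagram_class_homogeneous:
  assumes "D \<in> marked_diagrams r s"
  shows "diagram_class K r s \<delta> \<epsilon> D \<in> brauer_component K r s \<delta> \<epsilon> (diagram_degree K \<epsilon> D)"
proof -
  let ?A = "diagram_class K r s \<delta> \<epsilon> ` {D' \<in> marked_diagrams r s. diagram_degree K \<epsilon> D' = diagram_degree K \<epsilon> D}"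
  have "?A \<subseteq> carrier (brauer_space K r s \<delta> \<epsilon>)" using diagram_class_closed[OF K \<epsilon>] by blast
  then show ?thesis
    unfolding brauer_component_def using V.in_own_span[of ?A] assms by blast
qed

lemma standard_classes_homogeneous_basis:
  "homogeneous_basis K (brauer_space K r s \<delta> \<epsilon>) (brauer_component K r s \<delta> \<epsilon>)
     (diagram_class K r s \<delta> \<epsilon> ` standard_diagrams r s)"
proof -
  have "\<exists>i. X \<in> brauer_component K r s \<delta> \<epsilon> i" if "X \<in> diagram_class K r s \<delta> \<epsilon> ` standard_diagrams r s" for X
    using that diagram_class_homogeneous by (auto simp: standard_diagrams_def)
  then show ?thesis
    unfolding homogeneous_basis_def
    using brauer_space_graded[OF K \<epsilon>] standard_classes_basis by blast
qed

lemma brauer_space_fin_dim: "V.fin_dim"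
  unfolding V.fin_dim_def
  using finite_standard_diagrams span_standard_classes diagram_class_closed[OF K \<epsilon>]
  by (intro exI[of _ "diagram_class K r s \<delta> \<epsilon> ` standard_diagrams r s"]) auto

lemma brauer_space_dim: "V.dim = card (brauer_diagrams r s)"
proof -
  have "V.dim = card (diagram_class K r s \<delta> \<epsilon> ` standard_diagrams r s)"
    using V.dim_basis standard_classes_basis finite_standard_diagrams by blast
  also have "\<dots> = card (standard_diagrams r s)"
    by (rule card_image[OF inj_on_diagram_class])
  also have "\<dots> = card (brauer_diagrams r s)"
    using card_image[OF inj_on_standard] standard_diagrams_fst by metis
  finally show ?thesis .
qed

end

text \<open>Injectivity is stated separately because a basis given as an image set does not show
  that distinct standard diagrams give distinct vectors. The factorial quotient is taken in the
  rationals, where division is exact.\<close>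

theorem theorem2p3p1:
  fixes K :: "('k, 'm) ring_scheme" (structure)
    and \<epsilon> \<delta> :: 'k
    and r s :: nat
  assumes "field K"
    and "characteristic K \<noteq> 2"
    and "\<epsilon> = \<one> \<or> \<epsilon> = \<ominus> \<one>"
    and "\<delta> \<in> carrier K"
    and "\<epsilon> = \<ominus> \<one> \<Longrightarrow> \<delta> = \<zero>"
  shows "inj_on (diagram_class K r s \<delta> \<epsilon>) (standard_diagrams r s) \<and>
    homogeneous_basis K (brauer_space K r s \<delta> \<epsilon>) (brauer_component K r s \<delta> \<epsilon>)
      (diagram_class K r s \<delta> \<epsilon> ` standard_diagrams r s) \<and>
    (\<forall>n. r + s = 2 * n \<longrightarrow>
      vectorspace.fin_dim K (brauer_space K r s \<delta> \<epsilon>) \<and>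
      rat_of_nat (vectorspace.dim K (brauer_space K r s \<delta> \<epsilon>)) = fact (2 * n) / (2 ^ n * fact n) \<and>
      vectorspace.dim K (brauer_space K r s \<delta> \<epsilon>) = (\<Prod>i = 1..n. 2 * i - 1))"
proof -
  interpret K: field K by (rule assms(1))
  \<comment> \<open>Squaring to \<open>\<one>\<close> treats both values of the sign at
    once.\<close>
  have \<epsilon>: "\<epsilon> \<in> carrier K" "\<epsilon> \<otimes> \<epsilon> = \<one>" using assms(3) by (auto simp: K.l_minus K.r_minus)
  note hyps = assms(1) \<epsilon>
  have dim: "vectorspace.dim K (brauer_space K r s \<delta> \<epsilon>) = (\<Prod>i = 1..n. 2 * i - 1)"
    if "r + s = 2 * n" for n
    using brauer_space_dim[OF hyps] card_brauer_diagrams[OF that] by simp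
  have "rat_of_nat (vectorspace.dim K (brauer_space K r s \<delta> \<epsilon>)) = fact (2 * n) / (2 ^ n * fact n)"
    if "r + s = 2 * n" for n
    unfolding dim[OF that] by (rule prod_odd_eq_fact_quotient)
  then show ?thesis
    using inj_on_diagram_class[OF hyps] standard_classes_homogeneous_basis[OF hyps]
      brauer_space_fin_dim[OF hyps] dim by blast
qed

end
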